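(* Let $\mathcal M$ be a set of $N$ men and $\mathcal W$ a set of $N$ women, let $P:\mathcal M\times\mathcal W\to\mathbb R_{>0}$, and let the preference profile be sampled from the symmetric anti-popularity preference distribution defined by $P$. Let $\sigma:\mathcal M\cup\mathcal W\to\mathcal M\cup\mathcal W$ be a fixed bijection with $\sigma(\mathcal M)\subseteq\mathcal W$ and $\sigma(\mathcal W)\subseteq\mathcal M$. The probability that $\sigma$ is stable is $$\mathbb P[\sigma\text{ is stable}]=\int_{[0,1]^{\mathcal M}}\int_{[0,1]^{\mathcal W}} \prod_{\substack{m,w\\ \sigma(m)=w\\ \sigma(w)\neq m}}\mathbf x_m^{\frac{P(m,\sigma^{-1}(m))}{P(m,w)}} \prod_{\substack{m,w\\ \sigma(m)\neq w\\ \sigma(w)=m}}\mathbf y_w^{\frac{P(\sigma^{-1}(w),w)}{P(m,w)}} \prod_{\substack{m,w\\ \sigma(m)\neq w\\ \sigma(w)\neq m}}\Big(1-\mathbf x_m^{\frac{P(m,\sigma^{-1}(m))}{P(m,w)}}\,\mathbf y_w^{\frac{P(\sigma^{-1}(w),w)}{P(m,w)}}\Big)\,\mathrm d\mathbf y\,\mathrm d\mathbf x,$$ where $\mathbf x=(\mathbf x_m)_{m\in\mathcal M}$, $\mathbf y=(\mathbf y_w)_{w\in\mathcal W}$, and each product ranges over the pairs $(m,w)\in\mathcal M\times\mathcal W$ satisfying the indicated conditions.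
   Context: A preference profile gives each man $m$ a strict total order $\succ_m$ over $\mathcal W$ and each woman $w$ a strict total order $\succ_w$ over $\mathcal M$. Symmetric anti-popularity preference distribution defined by $P$: the preference lists of all $2N$ agents are mutually independent. Each man $m$ builds his list from the end, by sampling without replacement from the distribution on $\mathcal W$ that gives woman $w$ probability proportional to $1/P(m,w)$: he first samples his least preferred woman, then his second least preferred, and so on up to his favourite (at each step a woman $w$ not yet sampled is chosen with probability $1/P(m,w)$ divided by the sum of $1/P(m,w')$ over the women $w'$ not yet sampled). Symmetrically, each woman $w$ builds her list from the end, by sampling without replacement from the distribution on $\mathcal M$ that gives man $m$ probability proportional to $1/P(m,w)$. A permutation here means a bijection $\sigma$ of $\mathcal M\cup\mathcal W$ with $\sigma(\mathcal M)\subseteq\mathcal W$ and $\sigma(\mathcal W)\subseteq\mathcal M$. Given a preference profile, $\sigma$ is stable if (i) $\sigma(x)\succeq_x\sigma^{-1}(x)$ for every $x\in\mathcal M\cup\mathcal W$, and (ii) there is no pair $(m,w)\in\mathcal M\times\mathcal W$ with both $w\succ_m\sigma^{-1}(m)$ and $m\succ_w\sigma^{-1}(w)$. *)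

theory Defs
  imports "HOL-Probability.Probability"
begin

definition weighted_pmf :: "('a \<Rightarrow> real) \<Rightarrow> 'a set \<Rightarrow> 'a pmf" where
  "weighted_pmf f A = embed_pmf (\<lambda>x. if x \<in> A then f x / (\<Sum>y\<in>A. f y) else 0)"

text \<open>\<open>embed_pmf\<close> is unspecified on functions that are not probability mass functions; positive
  weights on a nonempty finite set do yield one.\<close>

lemma pmf_weighted_pmf:
  assumes "finite A" "A \<noteq> {}" "\<And>x. x \<in> A \<Longrightarrow> f x > 0"
  shows "pmf (weighted_pmf f A) x = (if x \<in> A then f x / (\<Sum>y\<in>A. f y) else 0)"
proof -
  let ?g = "\<lambda>x. if x \<in> A then f x / (\<Sum>y\<in>A. f y) else 0"
  have pos: "(\<Sum>y\<in>A. f y) > 0"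
    using assms by (intro sum_pos) auto
  have nonneg: "?g x \<ge> 0" for x
    using pos assms(3) by (auto intro!: divide_nonneg_pos less_imp_le)
  have "(\<integral>\<^sup>+ x. ennreal (?g x) \<partial>count_space UNIV) = (\<Sum>x\<in>A. ennreal (?g x))"
    using assms(1) by (intro nn_integral_count_space'[where A = A]) auto
  also have "\<dots> = ennreal (\<Sum>x\<in>A. ?g x)"
    using nonneg by (rule sum_ennreal)
  also have "(\<Sum>x\<in>A. ?g x) = 1"
    using pos by (simp add: sum_divide_distrib[symmetric])
  finally have "(\<integral>\<^sup>+ x. ennreal (?g x) \<partial>count_space UNIV) = 1" by simp
  then show ?thesis
    unfolding weighted_pmf_def using nonneg by (subst pmf_embed_pmf) auto
qed

text \<open>Successive sampling of \<open>n\<close> elements without replacement. Each element drawn is put behind all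
  those drawn after it, so the first draw is the last entry of the list (the least preferred
  candidate) and the head of the list is the favourite.\<close>

primrec sample_from_end :: "nat \<Rightarrow> ('a \<Rightarrow> real) \<Rightarrow> 'a set \<Rightarrow> 'a list pmf" where
  "sample_from_end 0 f A = return_pmf []"
| "sample_from_end (Suc n) f A =
     bind_pmf (weighted_pmf f A)
       (\<lambda>a. map_pmf (\<lambda>xs. xs @ [a]) (sample_from_end n f (A - {a})))"

text \<open>Throughout, \<open>(a, b)\<close> belongs to a preference order iff \<open>a\<close> is strictly preferred to \<open>b\<close>.\<close>

definition order_of_list :: "'a list \<Rightarrow> 'a rel" where
  "order_of_list xs = {(xs ! i, xs ! j) | i j. i < j \<and> j < length xs}"

definition anti_popularity_order :: "('a \<Rightarrow> real) \<Rightarrow> 'a set \<Rightarrow> 'a rel pmf" where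
  "anti_popularity_order p A =
     map_pmf order_of_list (sample_from_end (card A) (\<lambda>a. 1 / p a) A)"

lemma set_pmf_sample_from_end:
  assumes "finite A" "\<And>x. x \<in> A \<Longrightarrow> f x > 0" "xs \<in> set_pmf (sample_from_end (card A) f A)"
  shows "distinct xs \<and> set xs = A"
  using assms
proof (induction "card A" arbitrary: A xs)
  case 0
  then show ?case by auto
next
  case (Suc n)
  have ne: "A \<noteq> {}" using Suc.hyps(2) by auto
  from Suc.prems(3) obtain a ys where a: "a \<in> set_pmf (weighted_pmf f A)"
    and ys: "ys \<in> set_pmf (sample_from_end n f (A - {a}))" and xs: "xs = ys @ [a]"
    unfolding Suc.hyps(2)[symmetric] by auto
  have aA: "a \<in> A"
    using a pmf_weighted_pmf[OF Suc.prems(1) ne Suc.prems(2), where x = a]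
    by (auto simp: set_pmf_iff split: if_splits)
  have c: "n = card (A - {a})" using aA Suc.hyps(2) Suc.prems(1) by simp
  have "distinct ys \<and> set ys = A - {a}"
    using Suc.hyps(1)[OF c] Suc.prems(1,2) ys c by auto
  then show ?case using aA xs by auto
qed

lemma strict_linear_order_on_order_of_list:
  assumes "distinct xs"
  shows "strict_linear_order_on (set xs) (order_of_list xs)"
  unfolding strict_linear_order_on_def
proof (intro conjI)
  show "trans (order_of_list xs)"
    using assms unfolding trans_def order_of_list_def
    by (force simp: nth_eq_iff_index_eq)
  show "irrefl (order_of_list xs)"
    using assms unfolding irrefl_def order_of_list_def
    by (force simp: nth_eq_iff_index_eq)
  show "total_on (set xs) (order_of_list xs)"
    unfolding total_on_def order_of_list_def
    by (clarsimp simp: in_set_conv_nth) (metis linorder_neqE_nat)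
qed

lemma strict_linear_order_on_anti_popularity_order:
  assumes "finite A" "\<And>a. a \<in> A \<Longrightarrow> p a > 0" "r \<in> set_pmf (anti_popularity_order p A)"
  shows "strict_linear_order_on A r"
  using assms set_pmf_sample_from_end[of A "\<lambda>a. 1 / p a"] strict_linear_order_on_order_of_list
  by (fastforce simp: anti_popularity_order_def)

text \<open>A preference profile maps every agent to his or her preference order over the agents of the
  other side. Outside \<open>M \<union> W\<close> the profile is (irrelevantly) the empty relation.\<close>

definition symmetric_anti_popularity ::
  "'a set \<Rightarrow> 'a set \<Rightarrow> ('a \<Rightarrow> 'a \<Rightarrow> real) \<Rightarrow> ('a \<Rightarrow> 'a rel) pmf" where
  "symmetric_anti_popularity M W P =
     Pi_pmf (M \<union> W) {} (\<lambda>a. if a \<in> M then anti_popularity_order (\<lambda>w. P a w) W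
                              else anti_popularity_order (\<lambda>m. P m a) M)"

definition stable_permutation :: "'a set \<Rightarrow> 'a set \<Rightarrow> ('a \<Rightarrow> 'a rel) \<Rightarrow> ('a \<Rightarrow> 'a) \<Rightarrow> bool" where
  "stable_permutation M W pref \<sigma> \<longleftrightarrow>
     (let \<tau> = inv_into (M \<union> W) \<sigma> in
       (\<forall>x\<in>M \<union> W. \<sigma> x = \<tau> x \<or> (\<sigma> x, \<tau> x) \<in> pref x) \<and>
       \<not> (\<exists>m\<in>M. \<exists>w\<in>W. (w, \<tau> m) \<in> pref m \<and> (m, \<tau> w) \<in> pref w))"

end

theory Submission
  imports Defs
begin

text \<open>
  Conditioning on the first draw shows that an agent prefers every member of a set \<open>S\<close> to \<open>a\<close> with
  probability \<open>1 / (1 + (\<Sum>s\<in>S. p a / p s))\<close>, which is also the integral of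
  \<open>\<Prod>s\<in>S. x powr (p a / p s)\<close> over the unit interval. The indicator of stability and the integrand
  have the same shape: a product of factors \<open>A\<close> (one per pair, about the man), of factors \<open>B\<close> (about
  the woman) and of factors \<open>1 - A * B\<close>. Expanding the latter over sets of pairs gives a signed sum
  of products that factorise over the independent agents, respectively over the coordinates, and
  the two sums agree term by term.
\<close>

section \<open>Sampling without replacement from the end\<close>

lemma prob_bind_pmf:
  "measure_pmf.prob (bind_pmf p f) X = measure_pmf.expectation p (\<lambda>x. measure_pmf.prob (f x) X)"
proof -
  have int: "integrable (measure_pmf p) (\<lambda>x. measure_pmf.prob (f x) X)"
    by (rule measure_pmf.integrable_const_bound[where B = 1]) auto
  have "ennreal (measure_pmf.prob (bind_pmf p f) X) = (\<integral>\<^sup>+ x. ennreal (measure_pmf.prob (f x) X) \<partial>measure_pmf p)"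
    by (simp flip: measure_pmf.emeasure_eq_measure)
  also have "\<dots> = ennreal (measure_pmf.expectation p (\<lambda>x. measure_pmf.prob (f x) X))"
    by (rule nn_integral_eq_integral[OF int]) auto
  finally show ?thesis
    by (simp add: integral_nonneg_AE)
qed

text \<open>Peels off the first draw, which \<open>sample_from_end\<close> puts last: all other
  entries are preferred to it, and their mutual order is untouched.\<close>

lemma order_of_list_snoc: "order_of_list (xs @ [a]) = order_of_list xs \<union> set xs \<times> {a}"
proof (intro set_eqI iffI)
  fix z assume "z \<in> order_of_list (xs @ [a])"
  then show "z \<in> order_of_list xs \<union> set xs \<times> {a}"
    unfolding order_of_list_def by (auto simp: nth_append less_Suc_eq)
next
  fix z assume "z \<in> order_of_list xs \<union> set xs \<times> {a}"
  then consider i j where "z = (xs ! i, xs ! j)" "i < j" "j < length xs"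
    | i where "z = (xs ! i, a)" "i < length xs"
    unfolding order_of_list_def by (auto simp: in_set_conv_nth)
  then show "z \<in> order_of_list (xs @ [a])"
  proof cases
    case (1 i j)
    then show ?thesis
      unfolding order_of_list_def mem_Collect_eq
      by - (rule exI[of _ i], rule exI[of _ j], simp add: nth_append)
  next
    case (2 i)
    then show ?thesis
      unfolding order_of_list_def mem_Collect_eq
      by - (rule exI[of _ i], rule exI[of _ "length xs"], simp add: nth_append)
  qed
qed

lemma order_of_list_subset: "order_of_list xs \<subseteq> set xs \<times> set xs"
  unfolding order_of_list_def by auto

text \<open>The event says that \<open>p\<close> is the first element of \<open>insert p S\<close>
  to be drawn, so draws outside that set are irrelevant and the answer does not depend on the rest
  of \<open>A\<close>. This independence is what lets the induction on \<open>card A\<close>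
  close.\<close>

lemma prob_sample_from_end_all_before:
  assumes "finite A" "\<And>x. x \<in> A \<Longrightarrow> f x > 0" "p \<in> A" "S \<subseteq> A - {p}"
  shows "measure_pmf.prob (sample_from_end (card A) f A) {xs. \<forall>s\<in>S. (s, p) \<in> order_of_list xs} =
           f p / (f p + sum f S)"
  using assms
proof (induction "card A" arbitrary: A)
  case 0
  then show ?case by auto
next
  case (Suc n)
  let ?F = "sum f A" and ?E = "{xs. \<forall>s\<in>S. (s, p) \<in> order_of_list xs}"
  let ?q = "f p / (f p + sum f S)"
  have ne: "A \<noteq> {}" using Suc.prems by auto
  have finS: "finite S" and SA: "S \<subseteq> A" and pS: "p \<notin> S"
    using Suc.prems(1,4) finite_subset by auto
  have Fpos: "?F > 0" using Suc.prems(1,2) ne by (intro sum_pos) auto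
  have qpos: "f p + sum f S > 0"
    using Suc.prems(2,3) SA by (intro add_pos_nonneg sum_nonneg) (auto intro: less_imp_le)
  have pmfw: "pmf (weighted_pmf f A) a = (if a \<in> A then f a / ?F else 0)" for a
    using Suc.prems(1,2) ne by (intro pmf_weighted_pmf)
  \<comment> \<open>Conditional on the first draw \<open>a\<close>: drawing \<open>p\<close> settles
    the event, drawing a member of \<open>S\<close> ruins it, and any other draw leaves the same
    problem on \<open>A - {a}\<close>.\<close>
  have step: "measure_pmf.prob (map_pmf (\<lambda>xs. xs @ [a]) (sample_from_end n f (A - {a}))) ?E =
      (if a = p then 1 else if a \<in> S then 0 else ?q)" if a: "a \<in> A" for a
  proof -
    let ?s = "sample_from_end n f (A - {a})"
    have n: "n = card (A - {a})" using Suc.hyps(2) a Suc.prems(1) by simp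
    have supp: "distinct xs \<and> set xs = A - {a}" if "xs \<in> set_pmf ?s" for xs
      using set_pmf_sample_from_end[of "A - {a}" f xs] that Suc.prems(1,2) n by auto
    consider "a = p" | "a \<noteq> p" "a \<in> S" | "a \<noteq> p" "a \<notin> S" by blast
    then show ?thesis
    proof cases
      case 1
      have "measure_pmf.prob ?s ((\<lambda>xs. xs @ [a]) -` ?E) = 1"
        using supp Suc.prems(4) 1
        by (subst measure_pmf.prob_eq_1) (auto simp: AE_measure_pmf_iff order_of_list_snoc)
      then show ?thesis using 1 by simp
    next
      case 2
      \<comment> \<open>Here \<open>a\<close> is last in the list and absent from \<open>xs\<close>,
        so no pair of the order has \<open>a\<close> as its preferred component; in particular
        \<open>(a, p)\<close> is missing.\<close>
      have "measure_pmf.prob ?s ((\<lambda>xs. xs @ [a]) -` ?E) = 0"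
        using supp order_of_list_subset 2
        by (subst measure_pmf.prob_eq_0) (fastforce simp: AE_measure_pmf_iff order_of_list_snoc)+
      then show ?thesis using 2 by simp
    next
      case 3
      \<comment> \<open>All pairs gained by appending \<open>a\<close> have second component
        \<open>a\<close>, which differs from \<open>p\<close>.\<close>
      have "(\<lambda>xs. xs @ [a]) -` ?E = ?E"
        using 3 by (auto simp: order_of_list_snoc)
      moreover have "measure_pmf.prob ?s ?E = ?q"
        using Suc.hyps(1)[OF n] Suc.prems 3 n by auto
      ultimately show ?thesis using 3 by simp
    qed
  qed
  have "measure_pmf.prob (sample_from_end (card A) f A) ?E =
      measure_pmf.expectation (weighted_pmf f A)
        (\<lambda>a. measure_pmf.prob (map_pmf (\<lambda>xs. xs @ [a]) (sample_from_end n f (A - {a}))) ?E)"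
    unfolding Suc.hyps(2)[symmetric] sample_from_end.simps by (rule prob_bind_pmf)
  also have "\<dots> = (\<Sum>a\<in>A. measure_pmf.prob (map_pmf (\<lambda>xs. xs @ [a]) (sample_from_end n f (A - {a}))) ?E *
      pmf (weighted_pmf f A) a)"
    by (intro integral_measure_pmf_real Suc.prems(1)) (simp add: set_pmf_iff pmfw split: if_splits)
  also have "\<dots> = (\<Sum>a\<in>A. (if a = p then 1 else if a \<in> S then 0 else ?q) * (f a / ?F))"
    by (intro sum.cong refl) (simp only: step pmfw if_True)
  \<comment> \<open>Within \<open>insert p S\<close> only the draw \<open>p\<close> counts; every
    draw outside it carries the same conditional value \<open>?q\<close>.\<close>
  also have "\<dots> = (\<Sum>a\<in>insert p S. (if a = p then 1 else 0) * (f a / ?F)) +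
      (\<Sum>a\<in>A - insert p S. ?q * (f a / ?F))"
    using Suc.prems(1,3) SA finS
    by (subst sum.subset_diff[of "insert p S" A])
       (auto simp: add.commute intro!: arg_cong2[of _ _ _ _ "(+)"] sum.cong)
  also have "(\<Sum>a\<in>insert p S. (if a = p then 1 else 0) * (f a / ?F)) = f p / ?F"
    using finS pS by (subst sum.insert) (auto intro!: sum.neutral)
  also have "(\<Sum>a\<in>A - insert p S. ?q * (f a / ?F)) = ?q * ((?F - (f p + sum f S)) / ?F)"
    using Suc.prems(1,3) SA finS pS
    by (simp add: sum_diff flip: sum_distrib_left sum_divide_distrib)
  \<comment> \<open>\<open>?q\<close> is the fixed point of the recursion: hit \<open>p\<close> at
    once, or draw outside \<open>insert p S\<close> and face the chance \<open>?q\<close>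
    again.\<close>
  also have "f p / ?F + ?q * ((?F - (f p + sum f S)) / ?F) = ?q"
  proof -
    have "x / F + x / g * ((F - g) / F) = x / g" if "F > 0" "g > 0" for x F g :: real
      using that by (simp add: field_simps)
    then show ?thesis using Fpos qpos by blast
  qed
  finally show ?case .
qed

text \<open>The previous formula with weights \<open>1 / p\<close>, scaled by \<open>p a\<close> so
  that the exponents of the integral appear as the ratios \<open>p a / p s\<close>.\<close>

lemma prob_anti_popularity_order_all_preferred:
  assumes "finite A" "\<And>x. x \<in> A \<Longrightarrow> p x > 0" "a \<in> A" "S \<subseteq> A - {a}"
  shows "measure_pmf.prob (anti_popularity_order p A) {r. \<forall>s\<in>S. (s, a) \<in> r} =
           1 / (1 + (\<Sum>s\<in>S. p a / p s))"
proof -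
  have pos: "p a > 0" using assms by auto
  have "measure_pmf.prob (anti_popularity_order p A) {r. \<forall>s\<in>S. (s, a) \<in> r} =
      (1 / p a) / (1 / p a + (\<Sum>s\<in>S. 1 / p s))"
    using prob_sample_from_end_all_before[of A "\<lambda>x. 1 / p x" a S] assms
    by (simp add: anti_popularity_order_def vimage_def)
  also have "1 / p a + (\<Sum>s\<in>S. 1 / p s) = (1 + (\<Sum>s\<in>S. p a / p s)) / p a"
    using pos by (simp add: add_divide_distrib sum_divide_distrib)
  finally show ?thesis using pos by simp
qed

section \<open>Integrals of products of powers over the unit cube\<close>

text \<open>Away from \<open>0\<close> the integrand is a single power with exponent
  \<open>sum c S\<close>. For \<open>c s = p a / p s\<close> the value is exactly the probability
  that an agent prefers all of \<open>S\<close> to \<open>a\<close>.\<close>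

lemma unit_interval_prod_powr:
  fixes c :: "'b \<Rightarrow> real"
  assumes "finite S" "\<And>s. s \<in> S \<Longrightarrow> c s > 0"
  defines "g \<equiv> \<lambda>x. indicator {0..1} x * (\<Prod>s\<in>S. x powr c s)"
  shows "integrable lborel g" "integral\<^sup>L lborel g = 1 / (1 + sum c S)"
proof -
  let ?h = "\<lambda>x::real. \<Prod>s\<in>S. x powr c s"
  have nn: "sum c S \<ge> 0" using assms(2) by (intro sum_nonneg) (auto intro: less_imp_le)
  have "((\<lambda>x. x powr sum c S) has_integral (1 powr (sum c S + 1) / (sum c S + 1))) {0..1::real}"
    using nn by (intro has_integral_powr_from_0) auto
  \<comment> \<open>At \<open>0\<close> this fails for empty \<open>S\<close>, because \<open>0 powr 0 = 0\<close>.\<close>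
  moreover have "?h x = x powr sum c S" if "x \<in> {0..1} - {0}" for x :: real
    using that by (simp add: powr_sum)
  ultimately have hi: "(?h has_integral (1 / (1 + sum c S))) {0..1}"
    by (intro has_integral_spike_finite[of "{0}" "{0..1}" ?h "\<lambda>x. x powr sum c S"])
       (simp_all add: add.commute)
  \<comment> \<open>A nonnegative gauge-integrable function is Lebesgue integrable on the
    completion; Borel measurability brings this down to \<open>lborel\<close>.\<close>
  have "set_integrable lebesgue {0..1} ?h"
    by (intro nonnegative_absolutely_integrable_1 has_integral_integrable[OF hi] prod_nonneg) auto
  then have si: "set_integrable lborel {0..1} ?h"
    unfolding set_integrable_def by (subst (asm) integrable_completion) auto
  show "integrable lborel g"
    using si unfolding set_integrable_def g_def by simp
  show "integral\<^sup>L lborel g = 1 / (1 + sum c S)"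
    using set_borel_integral_eq_integral(2)[OF si] integral_unique[OF hi]
    unfolding set_lebesgue_integral_def g_def by simp
qed

lemma prod_relation_rows:
  fixes g :: "'a \<Rightarrow> 'b \<Rightarrow> 'c::comm_monoid_mult"
  assumes "finite I" "finite D" "Domain D \<subseteq> I"
  shows "(\<Prod>(i, j)\<in>D. g i j) = (\<Prod>i\<in>I. \<Prod>j\<in>D `` {i}. g i j)"
proof -
  have "D = Sigma I (\<lambda>i. D `` {i})" using assms(3) by auto
  then have "(\<Prod>(i, j)\<in>D. g i j) = (\<Prod>(i, j)\<in>Sigma I (\<lambda>i. D `` {i}). g i j)" by simp
  also have "\<dots> = (\<Prod>i\<in>I. \<Prod>j\<in>D `` {i}. g i j)"
    using assms by (intro prod.Sigma[symmetric]) auto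
  finally show ?thesis .
qed

text \<open>Grouping the pairs by first coordinate turns the integrand into a product of functions
  of one coordinate each, so the integral factorises. A coordinate with an empty row contributes the
  factor \<open>1\<close>.\<close>

lemma unit_cube_prod_powr:
  fixes c :: "'a \<Rightarrow> 'b \<Rightarrow> real"
  assumes I: "finite I" and D: "finite D" "Domain D \<subseteq> I"
    and c: "\<And>i j. (i, j) \<in> D \<Longrightarrow> c i j > 0"
  shows "set_integrable (\<Pi>\<^sub>M i\<in>I. lborel) (\<Pi>\<^sub>E i\<in>I. {0..1}) (\<lambda>x. \<Prod>(i, j)\<in>D. x i powr c i j)"
    and "(LINT x : (\<Pi>\<^sub>E i\<in>I. {0..1}) | (\<Pi>\<^sub>M i\<in>I. lborel). \<Prod>(i, j)\<in>D. x i powr c i j) =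
      (\<Prod>i\<in>I. 1 / (1 + (\<Sum>j\<in>D `` {i}. c i j)))"
proof -
  interpret product_sigma_finite "\<lambda>_::'a. lborel :: real measure"
    by standard
  define g where "g = (\<lambda>i x. indicator {0..1} x * (\<Prod>j\<in>D `` {i}. x powr c i j))"
  have g: "integrable lborel (g i)" "integral\<^sup>L lborel (g i) = 1 / (1 + (\<Sum>j\<in>D `` {i}. c i j))" for i
    using unit_interval_prod_powr[of "D `` {i}" "c i"] D(1) c unfolding g_def by auto
  \<comment> \<open>The restriction to the space matters: at a non-extensional point the box
    indicator vanishes, whatever the coordinates in \<open>I\<close> are.\<close>
  have eq: "indicator (\<Pi>\<^sub>E i\<in>I. {0..1}) x *\<^sub>R (\<Prod>(i, j)\<in>D. x i powr c i j) = (\<Prod>i\<in>I. g i (x i))"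
    if "x \<in> space (\<Pi>\<^sub>M i\<in>I. lborel)" for x
  proof -
    have "indicator (\<Pi>\<^sub>E i\<in>I. {0..1}) x = (\<Prod>i\<in>I. indicator {0..1} (x i) :: real)"
      using that I by (auto simp: indicator_def PiE_iff space_PiM prod_zero_iff)
    then show ?thesis
      by (simp add: prod_relation_rows[OF I D] g_def prod.distrib)
  qed
  show "set_integrable (\<Pi>\<^sub>M i\<in>I. lborel) (\<Pi>\<^sub>E i\<in>I. {0..1}) (\<lambda>x. \<Prod>(i, j)\<in>D. x i powr c i j)"
    unfolding set_integrable_def
    using product_integrable_prod[OF I, of g] g(1)
    by (subst Bochner_Integration.integrable_cong[OF refl eq]) auto
  show "(LINT x : (\<Pi>\<^sub>E i\<in>I. {0..1}) | (\<Pi>\<^sub>M i\<in>I. lborel). \<Prod>(i, j)\<in>D. x i powr c i j) =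
      (\<Prod>i\<in>I. 1 / (1 + (\<Sum>j\<in>D `` {i}. c i j)))"
    unfolding set_lebesgue_integral_def
    using product_integral_prod[OF I, of g] g
    by (subst Bochner_Integration.integral_cong[OF refl eq]) auto
qed

section \<open>Signed expansion and independence of the agents\<close>

text \<open>\<open>E\<close> collects the indices at which \<open>- (a i * b i)\<close> is chosen
  over \<open>1\<close>. Disjointness lets the chosen factors join the products over
  \<open>D1\<close> and \<open>D2\<close>, so each summand separates into an \<open>a\<close> part
  and a \<open>b\<close> part.\<close>

lemma prod_mult_prod_one_minus:
  fixes a b :: "'i \<Rightarrow> 'r::comm_ring_1"
  assumes "finite D1" "finite D2" "finite D3" "D1 \<inter> D3 = {}" "D2 \<inter> D3 = {}"
  shows "(\<Prod>i\<in>D1. a i) * (\<Prod>i\<in>D2. b i) * (\<Prod>i\<in>D3. 1 - a i * b i) =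
    (\<Sum>E\<in>Pow D3. (-1) ^ card E * ((\<Prod>i\<in>D1 \<union> E. a i) * (\<Prod>i\<in>D2 \<union> E. b i)))"
proof -
  have un: "(\<Prod>i\<in>D \<union> E. h i) = (\<Prod>i\<in>D. h i) * (\<Prod>i\<in>E. h i)"
    if "E \<in> Pow D3" "finite D" "D \<inter> D3 = {}" for D E and h :: "'i \<Rightarrow> 'r"
    using that assms(3) by (intro prod.union_disjoint) (auto intro: finite_subset)
  have "(\<Prod>i\<in>D3. 1 - a i * b i) = (\<Prod>i\<in>D3. - (a i * b i) + 1)"
    by simp
  also have "\<dots> = (\<Sum>E\<in>Pow D3. (-1) ^ card E * ((\<Prod>i\<in>E. a i) * (\<Prod>i\<in>E. b i)))"
    by (subst prod_add[OF assms(3)]) (simp add: prod_uminus prod.distrib)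
  finally show ?thesis
    using assms by (simp add: sum_distrib_left un mult_ac)
qed

text \<open>Sorting \<open>A\<close> by men and \<open>B\<close> by women makes the event a
  rectangle with one condition per agent, so independence gives a product. The pairs excluded from
  \<open>A\<close> and \<open>B\<close> would ask an agent to prefer \<tau>'s value to
  itself.\<close>

lemma prob_symmetric_anti_popularity_all_preferred:
  fixes M W :: "'a set"
  assumes fin: "finite M" "finite W" and disj: "M \<inter> W = {}"
    and P_pos: "\<And>m w. m \<in> M \<Longrightarrow> w \<in> W \<Longrightarrow> P m w > 0"
    and \<tau>: "\<tau> ` M \<subseteq> W" "\<tau> ` W \<subseteq> M"
    and A: "A \<subseteq> M \<times> W" "\<And>m. (m, \<tau> m) \<notin> A"
    and B: "B \<subseteq> M \<times> W" "\<And>w. (\<tau> w, w) \<notin> B"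
  shows "measure_pmf.prob (symmetric_anti_popularity M W P)
      {pref. (\<forall>(m, w)\<in>A. (w, \<tau> m) \<in> pref m) \<and> (\<forall>(m, w)\<in>B. (m, \<tau> w) \<in> pref w)} =
    (\<Prod>m\<in>M. 1 / (1 + (\<Sum>w\<in>A `` {m}. P m (\<tau> m) / P m w))) *
    (\<Prod>w\<in>W. 1 / (1 + (\<Sum>m\<in>B\<inverse> `` {w}. P (\<tau> w) w / P m w)))"
proof -
  define p where "p = (\<lambda>a. if a \<in> M then anti_popularity_order (\<lambda>w. P a w) W
    else anti_popularity_order (\<lambda>m. P m a) M)"
  define S where "S = (\<lambda>a. if a \<in> M then A `` {a} else B\<inverse> `` {a})"
  have "{pref. (\<forall>(m, w)\<in>A. (w, \<tau> m) \<in> pref m) \<and> (\<forall>(m, w)\<in>B. (m, \<tau> w) \<in> pref w)} =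
      Pi (M \<union> W) (\<lambda>a. {r. \<forall>s\<in>S a. (s, \<tau> a) \<in> r})"
  proof (rule set_eqI)
    fix pref :: "'a \<Rightarrow> 'a rel"
    have "pref \<in> Pi (M \<union> W) (\<lambda>a. {r. \<forall>s\<in>S a. (s, \<tau> a) \<in> r}) \<longleftrightarrow>
        (\<forall>m\<in>M. \<forall>w\<in>A `` {m}. (w, \<tau> m) \<in> pref m) \<and> (\<forall>w\<in>W. \<forall>m\<in>B\<inverse> `` {w}. (m, \<tau> w) \<in> pref w)"
      unfolding Pi_iff ball_Un mem_Collect_eq using disj
      by (intro arg_cong2[of _ _ _ _ "(\<and>)"] ball_cong refl) (auto simp: S_def)
    then show "pref \<in> {pref. (\<forall>(m, w)\<in>A. (w, \<tau> m) \<in> pref m) \<and> (\<forall>(m, w)\<in>B. (m, \<tau> w) \<in> pref w)} \<longleftrightarrow>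
        pref \<in> Pi (M \<union> W) (\<lambda>a. {r. \<forall>s\<in>S a. (s, \<tau> a) \<in> r})"
      using A(1) B(1) by blast
  qed
  then have "measure_pmf.prob (symmetric_anti_popularity M W P)
      {pref. (\<forall>(m, w)\<in>A. (w, \<tau> m) \<in> pref m) \<and> (\<forall>(m, w)\<in>B. (m, \<tau> w) \<in> pref w)} =
      (\<Prod>a\<in>M \<union> W. measure_pmf.prob (p a) {r. \<forall>s\<in>S a. (s, \<tau> a) \<in> r})"
    using fin by (simp add: symmetric_anti_popularity_def measure_Pi_pmf_Pi flip: p_def)
  also have "\<dots> = (\<Prod>a\<in>M. measure_pmf.prob (p a) {r. \<forall>s\<in>S a. (s, \<tau> a) \<in> r}) *
      (\<Prod>a\<in>W. measure_pmf.prob (p a) {r. \<forall>s\<in>S a. (s, \<tau> a) \<in> r})"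
    using fin disj by (intro prod.union_disjoint) auto
  also have "(\<Prod>m\<in>M. measure_pmf.prob (p m) {r. \<forall>s\<in>S m. (s, \<tau> m) \<in> r}) =
      (\<Prod>m\<in>M. 1 / (1 + (\<Sum>w\<in>A `` {m}. P m (\<tau> m) / P m w)))"
  proof (intro prod.cong refl)
    fix m assume m: "m \<in> M"
    have "A `` {m} \<subseteq> W - {\<tau> m}" using A by auto
    then show "measure_pmf.prob (p m) {r. \<forall>s\<in>S m. (s, \<tau> m) \<in> r} =
        1 / (1 + (\<Sum>w\<in>A `` {m}. P m (\<tau> m) / P m w))"
      using prob_anti_popularity_order_all_preferred[of W "P m" "\<tau> m" "A `` {m}"] fin P_pos \<tau> m
      by (auto simp: p_def S_def)
  qed
  also have "(\<Prod>w\<in>W. measure_pmf.prob (p w) {r. \<forall>s\<in>S w. (s, \<tau> w) \<in> r}) =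
      (\<Prod>w\<in>W. 1 / (1 + (\<Sum>m\<in>B\<inverse> `` {w}. P (\<tau> w) w / P m w)))"
  proof (intro prod.cong refl)
    fix w assume w: "w \<in> W"
    then have "w \<notin> M" using disj by auto
    have "B\<inverse> `` {w} \<subseteq> M - {\<tau> w}" using B by auto
    then show "measure_pmf.prob (p w) {r. \<forall>s\<in>S w. (s, \<tau> w) \<in> r} =
        1 / (1 + (\<Sum>m\<in>B\<inverse> `` {w}. P (\<tau> w) w / P m w))"
      using prob_anti_popularity_order_all_preferred[of M "\<lambda>m. P m w" "\<tau> w" "B\<inverse> `` {w}"] fin P_pos \<tau> w
        \<open>w \<notin> M\<close> by (auto simp: p_def S_def)
  qed
  finally show ?thesis .
qed

lemma prod_of_bool:
  "finite D \<Longrightarrow> (\<Prod>i\<in>D. of_bool (Q i)) = (of_bool (\<forall>i\<in>D. Q i) :: 'r::comm_semiring_1)"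
  by (induction D rule: finite_induct) auto

theorem lemma5p1p1:
  fixes M W :: "'a set" and N :: nat and P :: "'a \<Rightarrow> 'a \<Rightarrow> real" and \<sigma> :: "'a \<Rightarrow> 'a"
  assumes fin: "finite M" "finite W" and disj: "M \<inter> W = {}"
    and card: "card M = N" "card W = N"
    and P_pos: "\<And>m w. m \<in> M \<Longrightarrow> w \<in> W \<Longrightarrow> P m w > 0"
    and bij: "bij_betw \<sigma> (M \<union> W) (M \<union> W)"
    and swap: "\<sigma> ` M \<subseteq> W" "\<sigma> ` W \<subseteq> M"
  shows "let \<tau> = inv_into (M \<union> W) \<sigma> in
    measure_pmf.prob (symmetric_anti_popularity M W P) {pref. stable_permutation M W pref \<sigma>} =
    (LINT x : (\<Pi>\<^sub>E m\<in>M. {0..1}) | (\<Pi>\<^sub>M m\<in>M. lborel).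
      (LINT y : (\<Pi>\<^sub>E w\<in>W. {0..1}) | (\<Pi>\<^sub>M w\<in>W. lborel).
        (\<Prod>(m, w)\<in>{(m, w). m \<in> M \<and> w \<in> W \<and> \<sigma> m = w \<and> \<sigma> w \<noteq> m}.
          x m powr (P m (\<tau> m) / P m w)) *
        (\<Prod>(m, w)\<in>{(m, w). m \<in> M \<and> w \<in> W \<and> \<sigma> m \<noteq> w \<and> \<sigma> w = m}.
          y w powr (P (\<tau> w) w / P m w)) *
        (\<Prod>(m, w)\<in>{(m, w). m \<in> M \<and> w \<in> W \<and> \<sigma> m \<noteq> w \<and> \<sigma> w \<noteq> m}.
          1 - x m powr (P m (\<tau> m) / P m w) * y w powr (P (\<tau> w) w / P m w))))"
proof -
  define \<tau> where "\<tau> = inv_into (M \<union> W) \<sigma>"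
  define D1 where "D1 = {(m, w). m \<in> M \<and> w \<in> W \<and> \<sigma> m = w \<and> \<sigma> w \<noteq> m}"
  define D2 where "D2 = {(m, w). m \<in> M \<and> w \<in> W \<and> \<sigma> m \<noteq> w \<and> \<sigma> w = m}"
  define D3 where "D3 = {(m, w). m \<in> M \<and> w \<in> W \<and> \<sigma> m \<noteq> w \<and> \<sigma> w \<noteq> m}"
  define a where "a = (\<lambda>x::'a \<Rightarrow> real. \<lambda>(m, w). x m powr (P m (\<tau> m) / P m w))"
  define b where "b = (\<lambda>y::'a \<Rightarrow> real. \<lambda>(m, w). y w powr (P (\<tau> w) w / P m w))"
  \<comment> \<open>\<open>rA\<close> and \<open>rB\<close> are the men's and women's factors of
    each summand; they arise both as probabilities and as cube integrals.\<close>
  define rA where "rA = (\<lambda>D. \<Prod>m\<in>M. 1 / (1 + (\<Sum>w\<in>D `` {m}. P m (\<tau> m) / P m w)))"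
  define rB where "rB = (\<lambda>D. \<Prod>w\<in>W. 1 / (1 + (\<Sum>m\<in>D\<inverse> `` {w}. P (\<tau> w) w / P m w)))"
  let ?p = "symmetric_anti_popularity M W P"

  \<comment> \<open>The inverse permutation and the three classes of pairs\<close>
  have inj: "inj_on \<sigma> (M \<union> W)" and img: "\<sigma> ` (M \<union> W) = M \<union> W"
    using bij by (auto simp: bij_betw_def)
  have \<sigma>M: "\<sigma> ` M = W" and \<sigma>W: "\<sigma> ` W = M"
    using img[unfolded image_Un] swap disj by blast+
  have \<tau>\<sigma>: "\<tau> (\<sigma> z) = z" if "z \<in> M \<union> W" for z
    unfolding \<tau>_def using that inj by (rule inv_into_f_f[rotated])
  have \<tau>: "\<tau> ` M \<subseteq> W" "\<tau> ` W \<subseteq> M"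
    using \<tau>\<sigma> \<sigma>M \<sigma>W by (auto simp: image_iff) (metis UnI1 UnI2 imageI image_iff)+
  have \<sigma>m: "\<sigma> m = w \<longleftrightarrow> \<tau> w = m" and \<sigma>w: "\<sigma> w = m \<longleftrightarrow> \<tau> m = w" if "m \<in> M" "w \<in> W" for m w
    using that \<tau>\<sigma> \<sigma>M \<sigma>W by (metis UnCI image_iff)+

  have D: "D1 \<subseteq> M \<times> W" "D2 \<subseteq> M \<times> W" "D3 \<subseteq> M \<times> W" "D1 \<inter> D3 = {}" "D2 \<inter> D3 = {}"
    by (auto simp: D1_def D2_def D3_def)
  have finD: "finite D1" "finite D2" "finite D3"
    using D fin by (meson finite_SigmaI finite_subset)+
  \<comment> \<open>\<open>(m, \<tau> m)\<close> would satisfy \<sigma> w = m, which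
    \<open>D1\<close> and \<open>D3\<close> forbid; \<open>(\<tau> w, w)\<close> would satisfy
    \<sigma> m = w, which \<open>D2\<close> and \<open>D3\<close> forbid.\<close>
  have sub: "D1 \<union> E \<subseteq> M \<times> W" "D2 \<union> E \<subseteq> M \<times> W" "finite (D1 \<union> E)" "finite (D2 \<union> E)"
    "\<And>m. (m, \<tau> m) \<notin> D1 \<union> E" "\<And>w. (\<tau> w, w) \<notin> D2 \<union> E" if "E \<in> Pow D3" for E
    using that D finD finite_subset \<sigma>m \<sigma>w by (auto simp: D1_def D2_def D3_def)

  \<comment> \<open>Stability as a product of indicators\<close>
  have irrefl: "(c, c) \<notin> pref z" if "pref \<in> set_pmf ?p" "z \<in> M \<union> W" for pref c z
  proof -
    have "pref z \<in> set_pmf (if z \<in> M then anti_popularity_order (\<lambda>w. P z w) W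
        else anti_popularity_order (\<lambda>m. P m z) M)"
      using that fin by (auto simp: symmetric_anti_popularity_def set_Pi_pmf PiE_dflt_def)
    then have "irrefl (pref z)"
      using strict_linear_order_on_anti_popularity_order[of W "\<lambda>w. P z w" "pref z"]
        strict_linear_order_on_anti_popularity_order[of M "\<lambda>m. P m z" "pref z"] fin P_pos that
      by (auto simp: strict_linear_order_on_def split: if_splits)
    then show ?thesis by (auto simp: irrefl_def)
  qed

  define A where "A = (\<lambda>pref::'a \<Rightarrow> 'a rel. \<lambda>(m, w). of_bool ((w, \<tau> m) \<in> pref m) :: real)"
  define B where "B = (\<lambda>pref::'a \<Rightarrow> 'a rel. \<lambda>(m, w). of_bool ((m, \<tau> w) \<in> pref w) :: real)"
  have stable: "indicator {pref. stable_permutation M W pref \<sigma>} pref =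
      (\<Prod>i\<in>D1. A pref i) * (\<Prod>i\<in>D2. B pref i) * (\<Prod>i\<in>D3. 1 - A pref i * B pref i)"
    if pref: "pref \<in> set_pmf ?p" for pref
  proof -
    \<comment> \<open>\<open>D1\<close> consists of the pairs \<open>(m, \<sigma> m)\<close> with
      \<sigma> m different from \<tau> m; the remaining men meet the condition by equality.\<close>
    have M1: "(\<forall>m\<in>M. \<sigma> m = \<tau> m \<or> (\<sigma> m, \<tau> m) \<in> pref m) \<longleftrightarrow> (\<forall>(m, w)\<in>D1. (w, \<tau> m) \<in> pref m)"
      using \<sigma>M \<sigma>w by (auto simp: D1_def)
    have W1: "(\<forall>w\<in>W. \<sigma> w = \<tau> w \<or> (\<sigma> w, \<tau> w) \<in> pref w) \<longleftrightarrow> (\<forall>(m, w)\<in>D2. (m, \<tau> w) \<in> pref w)"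
      using \<sigma>W \<sigma>m by (auto simp: D2_def)
    \<comment> \<open>A pair outside \<open>D3\<close> has w = \<tau> m or m = \<tau> w. Blocking
      would then need an agent to prefer someone to that same person, contrary to
      irreflexivity.\<close>
    have MW: "\<not> (\<exists>m\<in>M. \<exists>w\<in>W. (w, \<tau> m) \<in> pref m \<and> (m, \<tau> w) \<in> pref w) \<longleftrightarrow>
        (\<forall>(m, w)\<in>D3. \<not> ((w, \<tau> m) \<in> pref m \<and> (m, \<tau> w) \<in> pref w))"
      using irrefl[OF pref] \<sigma>m \<sigma>w by (auto simp: D3_def) (metis UnCI)+
    have st: "stable_permutation M W pref \<sigma> \<longleftrightarrow> (\<forall>(m, w)\<in>D1. (w, \<tau> m) \<in> pref m) \<and>
        (\<forall>(m, w)\<in>D2. (m, \<tau> w) \<in> pref w) \<and>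
        (\<forall>(m, w)\<in>D3. \<not> ((w, \<tau> m) \<in> pref m \<and> (m, \<tau> w) \<in> pref w))"
      unfolding stable_permutation_def Let_def \<tau>_def[symmetric] ball_Un M1 W1 MW by blast
    have "1 - A pref i * B pref i =
        of_bool (case i of (m, w) \<Rightarrow> \<not> ((w, \<tau> m) \<in> pref m \<and> (m, \<tau> w) \<in> pref w))" for i
      by (cases i) (auto simp: A_def B_def)
    moreover have "A pref i = of_bool (case i of (m, w) \<Rightarrow> (w, \<tau> m) \<in> pref m)"
      "B pref i = of_bool (case i of (m, w) \<Rightarrow> (m, \<tau> w) \<in> pref w)" for i
      by (cases i; simp add: A_def B_def)+
    ultimately show ?thesis
      using finD by (simp only: prod_of_bool of_bool_conj[symmetric] st indicator_def mem_Collect_eq conj_assoc)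
  qed
  have prodAB: "(\<Prod>i\<in>D. A pref i) * (\<Prod>i\<in>D'. B pref i) =
      indicator {pref. (\<forall>(m, w)\<in>D. (w, \<tau> m) \<in> pref m) \<and> (\<forall>(m, w)\<in>D'. (m, \<tau> w) \<in> pref w)} pref"
    if "finite D" "finite D'" for D D' pref
    using that by (simp add: A_def B_def case_prod_unfold prod_of_bool indicator_def flip: of_bool_conj)

  \<comment> \<open>The probability of stability as a signed sum\<close>
  have "measure_pmf.prob ?p {pref. stable_permutation M W pref \<sigma>} =
      measure_pmf.expectation ?p (indicator {pref. stable_permutation M W pref \<sigma>})"
    by simp
  also have "\<dots> = measure_pmf.expectation ?p (\<lambda>pref. \<Sum>E\<in>Pow D3. (-1) ^ card E *
      ((\<Prod>i\<in>D1 \<union> E. A pref i) * (\<Prod>i\<in>D2 \<union> E. B pref i)))"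
    \<comment> \<open>The product formula is known only on the support of \<open>?p\<close>, so the
      integrands are compared almost everywhere.\<close>
    using prod_mult_prod_one_minus[OF finD D(4,5)] stable
    by (intro integral_cong_AE) (auto simp: AE_measure_pmf_iff)
  also have "\<dots> = (\<Sum>E\<in>Pow D3. measure_pmf.expectation ?p (\<lambda>pref. (-1) ^ card E *
      ((\<Prod>i\<in>D1 \<union> E. A pref i) * (\<Prod>i\<in>D2 \<union> E. B pref i))))"
  proof (rule Bochner_Integration.integral_sum)
    fix E assume E: "E \<in> Pow D3"
    show "integrable (measure_pmf ?p) (\<lambda>pref. (-1) ^ card E *
        ((\<Prod>i\<in>D1 \<union> E. A pref i) * (\<Prod>i\<in>D2 \<union> E. B pref i)))"
      unfolding prodAB[OF sub(3,4)[OF E]]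
      by (intro integrable_mult_right measure_pmf.integrable_const_bound[where B = 1]) auto
  qed
  also have "\<dots> = (\<Sum>E\<in>Pow D3. (-1) ^ card E * (rA (D1 \<union> E) * rB (D2 \<union> E)))"
  proof (intro sum.cong refl)
    fix E assume E: "E \<in> Pow D3"
    show "measure_pmf.expectation ?p (\<lambda>pref. (-1) ^ card E *
        ((\<Prod>i\<in>D1 \<union> E. A pref i) * (\<Prod>i\<in>D2 \<union> E. B pref i))) =
        (-1) ^ card E * (rA (D1 \<union> E) * rB (D2 \<union> E))"
      unfolding prodAB[OF sub(3,4)[OF E]] integral_mult_right_zero rA_def rB_def
      using prob_symmetric_anti_popularity_all_preferred[OF fin disj P_pos \<tau> sub(1)[OF E] sub(5)[OF E]
        sub(2)[OF E] sub(6)[OF E]] by simp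
  qed
  finally have lhs: "measure_pmf.prob ?p {pref. stable_permutation M W pref \<sigma>} = \<dots>" .

  \<comment> \<open>The iterated integral as the same signed sum\<close>
  let ?X = "\<Pi>\<^sub>E m\<in>M. {0..1::real}" and ?Y = "\<Pi>\<^sub>E w\<in>W. {0..1::real}"
  let ?\<mu> = "\<Pi>\<^sub>M m\<in>M. (lborel :: real measure)" and ?\<nu> = "\<Pi>\<^sub>M w\<in>W. (lborel :: real measure)"
  have intA: "set_integrable ?\<mu> ?X (\<lambda>x. \<Prod>i\<in>D1 \<union> E. a x i)"
    "(LINT x : ?X | ?\<mu>. \<Prod>i\<in>D1 \<union> E. a x i) = rA (D1 \<union> E)" if E: "E \<in> Pow D3" for E
  proof -
    have "Domain (D1 \<union> E) \<subseteq> M" "\<And>m w. (m, w) \<in> D1 \<union> E \<Longrightarrow> P m (\<tau> m) / P m w > 0"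
      using sub(1)[OF E] \<tau> P_pos by (auto simp: image_subset_iff subset_iff)
    from unit_cube_prod_powr[of M "D1 \<union> E" "\<lambda>m w. P m (\<tau> m) / P m w", OF fin(1) sub(3)[OF E] this]
    show "set_integrable ?\<mu> ?X (\<lambda>x. \<Prod>i\<in>D1 \<union> E. a x i)"
      "(LINT x : ?X | ?\<mu>. \<Prod>i\<in>D1 \<union> E. a x i) = rA (D1 \<union> E)"
      by (simp_all add: a_def rA_def)
  qed
  have intB: "set_integrable ?\<nu> ?Y (\<lambda>y. \<Prod>i\<in>D2 \<union> E. b y i)"
    "(LINT y : ?Y | ?\<nu>. \<Prod>i\<in>D2 \<union> E. b y i) = rB (D2 \<union> E)" if E: "E \<in> Pow D3" for E
  proof -
    \<comment> \<open>The variables of \<open>y\<close> are indexed by the second component, so the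
      relation is transposed to make each woman a row.\<close>
    have fc: "finite ((D2 \<union> E)\<inverse>)" using sub(4)[OF E] by simp
    have "Domain ((D2 \<union> E)\<inverse>) \<subseteq> W" "\<And>w m. (w, m) \<in> (D2 \<union> E)\<inverse> \<Longrightarrow> P (\<tau> w) w / P m w > 0"
      using sub(2)[OF E] \<tau> P_pos by (auto simp: image_subset_iff subset_iff)
    note * = unit_cube_prod_powr[of W "(D2 \<union> E)\<inverse>" "\<lambda>w m. P (\<tau> w) w / P m w", OF fin(2) fc this]
    have eq: "(\<Prod>(w, m)\<in>(D2 \<union> E)\<inverse>. y w powr (P (\<tau> w) w / P m w)) = (\<Prod>i\<in>D2 \<union> E. b y i)" for y
      by (rule prod.reindex_bij_witness[of _ prod.swap prod.swap]) (auto simp: b_def)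
    show "set_integrable ?\<nu> ?Y (\<lambda>y. \<Prod>i\<in>D2 \<union> E. b y i)"
      "(LINT y : ?Y | ?\<nu>. \<Prod>i\<in>D2 \<union> E. b y i) = rB (D2 \<union> E)"
      using * unfolding eq rB_def by blast+
  qed
  have sum_set: "(LINT x : S | \<kappa>. \<Sum>E\<in>Pow D3. c E * f E x) = (\<Sum>E\<in>Pow D3. c E * (LINT x : S | \<kappa>. f E x))"
    if "\<And>E. E \<in> Pow D3 \<Longrightarrow> set_integrable \<kappa> S (f E)"
    for S and \<kappa> :: "('a \<Rightarrow> real) measure" and c :: "('a \<times> 'a) set \<Rightarrow> real"
      and f :: "('a \<times> 'a) set \<Rightarrow> ('a \<Rightarrow> real) \<Rightarrow> real"
  proof -
    have "(LINT x : S | \<kappa>. \<Sum>E\<in>Pow D3. c E * f E x) =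
        (\<integral>x. (\<Sum>E\<in>Pow D3. c E * (indicator S x *\<^sub>R f E x)) \<partial>\<kappa>)"
      by (simp add: set_lebesgue_integral_def sum_distrib_left mult_ac)
    also have "\<dots> = (\<Sum>E\<in>Pow D3. (\<integral>x. c E * (indicator S x *\<^sub>R f E x) \<partial>\<kappa>))"
      by (intro Bochner_Integration.integral_sum integrable_mult_right)
         (use that in \<open>auto simp: set_integrable_def\<close>)
    finally show ?thesis by (simp add: set_lebesgue_integral_def)
  qed
  \<comment> \<open>With \<open>x\<close> fixed, the \<open>a\<close> products are constants.
    Integrating out \<open>y\<close> leaves a linear combination of products of powers of
    \<open>x\<close>, ready for the outer integral; no interchange of integrals is needed.\<close>
  have inner: "(LINT y : ?Y | ?\<nu>. (\<Prod>i\<in>D1. a x i) * (\<Prod>i\<in>D2. b y i) * (\<Prod>i\<in>D3. 1 - a x i * b y i)) =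
      (\<Sum>E\<in>Pow D3. ((-1) ^ card E * rB (D2 \<union> E)) * (\<Prod>i\<in>D1 \<union> E. a x i))" for x
  proof -
    have "(LINT y : ?Y | ?\<nu>. (\<Prod>i\<in>D1. a x i) * (\<Prod>i\<in>D2. b y i) * (\<Prod>i\<in>D3. 1 - a x i * b y i)) =
        (LINT y : ?Y | ?\<nu>. \<Sum>E\<in>Pow D3. ((-1) ^ card E * (\<Prod>i\<in>D1 \<union> E. a x i)) * (\<Prod>i\<in>D2 \<union> E. b y i))"
      unfolding prod_mult_prod_one_minus[OF finD D(4,5)] by (simp only: mult.assoc)
    also have "\<dots> = (\<Sum>E\<in>Pow D3. ((-1) ^ card E * (\<Prod>i\<in>D1 \<union> E. a x i)) *
        (LINT y : ?Y | ?\<nu>. \<Prod>i\<in>D2 \<union> E. b y i))"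
      by (rule sum_set) (rule intB(1))
    also have "\<dots> = (\<Sum>E\<in>Pow D3. ((-1) ^ card E * rB (D2 \<union> E)) * (\<Prod>i\<in>D1 \<union> E. a x i))"
      by (intro sum.cong refl) (simp only: intB(2) mult_ac)
    finally show ?thesis .
  qed
  have rhs: "(LINT x : ?X | ?\<mu>. (LINT y : ?Y | ?\<nu>. (\<Prod>i\<in>D1. a x i) * (\<Prod>i\<in>D2. b y i) *
      (\<Prod>i\<in>D3. 1 - a x i * b y i))) = (\<Sum>E\<in>Pow D3. (-1) ^ card E * (rA (D1 \<union> E) * rB (D2 \<union> E)))"
    unfolding inner by (subst sum_set) (auto simp: intA mult_ac intro!: sum.cong)
  show ?thesis
    using lhs rhs unfolding Let_def \<tau>_def[symmetric] D1_def[symmetric] D2_def[symmetric] D3_def[symmetric]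
    by (simp add: a_def b_def case_prod_unfold)
qed

end
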